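(* Let $d\geq 1$ and let $(e_{k,l})_{1\leq k\leq l\leq d}$ be a fixed family of elements of $C_d=\{0,1\}^d$ satisfying the binary tree assumption (H) stated in the context. Let $$X=(X_1,\ldots,X_d)=\sum_{1\leq k\leq l\leq d}X_{k,l}\,e_{k,l},\qquad Y=(Y_1,\ldots,Y_d)=\sum_{1\leq k\leq l\leq d}Y_{k,l}\,e_{k,l},$$ where $(X_{k,l})_{1\leq k\leq l\leq d}$ is a family of independent Poisson random variables with intensities $a_{k,l}\geq 0$ and $(Y_{k,l})_{1\leq k\leq l\leq d}$ is a family of independent Poisson random variables with intensities $b_{k,l}\geq 0$. Then the conditions $$E[X_i]=E[Y_i],\qquad 1\leq i\leq d,$$ and $$\mathrm{Cov}(X_i,X_j)\leq\mathrm{Cov}(Y_i,Y_j),\qquad 1\leq i<j\leq d,$$ are (together) necessary and sufficient for the supermodular ordering $X\leq_{\rm sm}Y$.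
   Context: Hypercube and order: $C_d=\{0,1\}^d\subset\mathbb{R}^d$ is identified with the power set of $\{1,\ldots,d\}$ (a vector $x\in C_d$ is identified with $\{i: x_i=1\}$), ordered by inclusion. The canonical basis vector $e_k$ is identified with the singleton $\{k\}$. With this identification, $X_i=\sum_{1\leq k\leq l\leq d,\ i\in e_{k,l}}X_{k,l}$, and similarly for $Y_i$. Assumption (H): $(e_{k,l})_{1\leq k\leq l\leq d}$ is a family of $d(d+1)/2$ pairwise distinct elements of $C_d$ with $e_{k,k}=e_k$ for $k=1,\ldots,d$ (the leaves), and, for all $1\leq k<l\leq d$, one has $k,l\in e_{k,l}$ and both sets $e_{k,l}\setminus\{k\}$ and $e_{k,l}\setminus\{l\}$ (the two children of the node $e_{k,l}$) again belong to the family. A Poisson random variable with intensity $0$ is identically $0$. Supermodular order: a function $\Phi:\mathbb{R}^d\to\mathbb{R}$ is supermodular if $\Phi(x)+\Phi(y)\leq\Phi(x\wedge y)+\Phi(x\vee y)$ for all $x,y\in\mathbb{R}^d$, where $\wedge,\vee$ are the componentwise minimum and maximum. For $d$-dimensional random vectors, $X\leq_{\rm sm}Y$ means $E[\Phi(X)]\leq E[\Phi(Y)]$ for all supermodular $\Phi$ such that $\Phi(X)$ and $\Phi(Y)$ are integrable. *)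

theory Defs
  imports "HOL-Probability.Probability"
begin

text \<open>
  The coordinates \<open>1, \<dots>, d\<close> are the elements of a linearly ordered finite type \<open>'n\<close> with
  \<open>d = CARD('n)\<close>, and \<open>\<real>\<^sup>d\<close> is \<^typ>\<open>real ^ 'n\<close>. Elements of the hypercube \<open>{0,1}\<^sup>d\<close> are given
  as subsets of \<open>'n\<close>; \<open>cube_vec\<close> is the corresponding 0/1 vector.
\<close>

definition cube_vec :: "'n::finite set \<Rightarrow> real ^ 'n" where
  "cube_vec S = (\<chi> i. indicator S i)"

definition index_pairs :: "('n::linorder \<times> 'n) set" where
  "index_pairs = {(k, l). k \<le> l}"

definition binary_tree_family :: "('n::{finite, linorder} \<times> 'n \<Rightarrow> 'n set) \<Rightarrow> bool" where
  "binary_tree_family e \<longleftrightarrow>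
     inj_on e index_pairs \<and>
     (\<forall>k. e (k, k) = {k}) \<and>
     (\<forall>k l. k < l \<longrightarrow>
        k \<in> e (k, l) \<and> l \<in> e (k, l) \<and>
        e (k, l) - {k} \<in> e ` index_pairs \<and> e (k, l) - {l} \<in> e ` index_pairs)"

text \<open>\<open>poisson_pmf\<close> is only specified for positive rates; rate 0 means the point mass at 0.\<close>

definition poisson_law :: "real \<Rightarrow> nat pmf" where
  "poisson_law a = (if a = 0 then return_pmf 0 else poisson_pmf a)"

definition independent_poisson_family ::
  "'a measure \<Rightarrow> ('i \<Rightarrow> real) \<Rightarrow> 'i set \<Rightarrow> ('i \<Rightarrow> 'a \<Rightarrow> nat) \<Rightarrow> bool" where
  "independent_poisson_family M a I X \<longleftrightarrow>
     prob_space.indep_vars M (\<lambda>_. count_space UNIV) X I \<and>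
     (\<forall>p\<in>I. distr M (count_space UNIV) (X p) = measure_pmf (poisson_law (a p)))"

definition tree_vector ::
  "('n \<times> 'n \<Rightarrow> 'n set) \<Rightarrow> ('n \<times> 'n \<Rightarrow> 'a \<Rightarrow> nat) \<Rightarrow> 'a \<Rightarrow> real ^ ('n::{finite, linorder})" where
  "tree_vector e X \<omega> = (\<Sum>p\<in>index_pairs. real (X p \<omega>) *\<^sub>R cube_vec (e p))"

definition covariance :: "'a measure \<Rightarrow> ('a \<Rightarrow> real) \<Rightarrow> ('a \<Rightarrow> real) \<Rightarrow> real" where
  "covariance M f g =
     prob_space.expectation M
       (\<lambda>\<omega>. (f \<omega> - prob_space.expectation M f) * (g \<omega> - prob_space.expectation M g))"

text \<open>On \<^typ>\<open>real ^ 'n\<close>, \<^const>\<open>inf\<close> and \<^const>\<open>sup\<close> are the componentwise minimum and maximum.\<close>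

definition supermodular :: "(real ^ 'n::finite \<Rightarrow> real) \<Rightarrow> bool" where
  "supermodular \<Phi> \<longleftrightarrow> (\<forall>x y. \<Phi> x + \<Phi> y \<le> \<Phi> (inf x y) + \<Phi> (sup x y))"

text \<open>The two random vectors may live on different probability spaces.\<close>

definition supermodular_le ::
  "'a measure \<Rightarrow> ('a \<Rightarrow> real ^ 'n::finite) \<Rightarrow> 'b measure \<Rightarrow> ('b \<Rightarrow> real ^ 'n) \<Rightarrow> bool" where
  "supermodular_le M X N Y \<longleftrightarrow>
     (\<forall>\<Phi>. supermodular \<Phi> \<longrightarrow>
          integrable M (\<lambda>\<omega>. \<Phi> (X \<omega>)) \<longrightarrow> integrable N (\<lambda>\<omega>. \<Phi> (Y \<omega>)) \<longrightarrow>
          prob_space.expectation M (\<lambda>\<omega>. \<Phi> (X \<omega>)) \<le> prob_space.expectation N (\<lambda>\<omega>. \<Phi> (Y \<omega>)))"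

end

theory Submission
  imports Defs
begin

text \<open>
  A member \<open>S\<close> of a binary tree family contains \<open>e (i, j)\<close> as soon as it contains \<open>i\<close> and \<open>j\<close>.
  Hence a set function \<open>\<phi>\<close> with \<open>\<phi> {} = 0\<close> is, on the family, the sum of its second differences
  \<open>\<psi> (i, j)\<close> over the pairs \<open>i \<le> j\<close> in \<open>S\<close>, and
  \<open>\<Sum>\<^sub>p (b p - a p) \<phi> (e p) = \<Sum>\<^sub>q \<psi> q (B q - A q)\<close> where \<open>A (i, j)\<close>, \<open>B (i, j)\<close> are the means
  (\<open>i = j\<close>) and covariances (\<open>i < j\<close>) of \<open>X\<close>, \<open>Y\<close>. For supermodular \<open>\<phi>\<close> the right-hand side is
  nonnegative under the moment conditions.

  To pass from the jump measures to \<open>X\<close> and \<open>Y\<close>, add jumps of size 0 so that both vectors have the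
  same total jump rate \<open>\<Lambda>\<close>. Conditionally on the number \<open>s\<close> of jumps both are sums of \<open>s\<close> independent
  jumps, so the conditional expectations of \<open>\<Phi>\<close> are finite sums, proportional to \<open>L\<^sup>s \<Phi> 0\<close> for the jump
  operators \<open>L\<close>. These operators preserve supermodularity, are monotone, and are ordered on
  supermodular functions; so the conditional expectations are ordered for every \<open>s\<close>, and integrability
  of \<open>\<Phi> (X)\<close> and \<open>\<Phi> (Y)\<close> is all that is needed to sum over \<open>s\<close>.
\<close>

section \<open>Second differences along a binary tree family\<close>

abbreviation pairs_in :: "'n::linorder set \<Rightarrow> ('n \<times> 'n) set" where
  "pairs_in S \<equiv> {q \<in> index_pairs. fst q \<in> S \<and> snd q \<in> S}"

text \<open>Case rule for inductions on \<open>card S\<close>: in the node case both children are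
  smaller members of the family, so the induction hypothesis covers them.\<close>

lemma binary_tree_family_cases:
  assumes "binary_tree_family e" "S \<in> e ` index_pairs"
  obtains (leaf) k where "S = {k}"
  | (node) k l where "k < l" "S = e (k, l)" "k \<in> S" "l \<in> S"
      "S - {k} \<in> e ` index_pairs" "S - {l} \<in> e ` index_pairs"
proof -
  obtain k l where kl: "k \<le> l" "S = e (k, l)"
    using assms(2) by (auto simp: index_pairs_def)
  show thesis
  proof (cases "k = l")
    case True
    then show thesis using leaf kl assms(1) by (auto simp: binary_tree_family_def)
  next
    case False
    then have "k < l" using kl by auto
    then have "k \<in> S" "l \<in> S" "S - {k} \<in> e ` index_pairs" "S - {l} \<in> e ` index_pairs"
      using assms(1) unfolding binary_tree_family_def kl(2) by metis+
    then show thesis by (rule node[OF \<open>k < l\<close> kl(2)])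
  qed
qed

text \<open>Descend from \<open>S\<close>: unless \<open>{i, j} = {k, l}\<close>, one of the two
  children of the node \<open>S = e (k, l)\<close> still contains both \<open>i\<close> and
  \<open>j\<close>. Thus \<open>e (i, j)\<close> is the least member containing \<open>i\<close> and
  \<open>j\<close>.\<close>

lemma binary_tree_family_subset:
  fixes e :: "'n::{finite, linorder} \<times> 'n \<Rightarrow> 'n set"
  assumes e: "binary_tree_family e" and S: "S \<in> e ` index_pairs"
    and ij: "i \<le> j" "i \<in> S" "j \<in> S"
  shows "e (i, j) \<subseteq> S"
  using S ij
proof (induction "card S" arbitrary: S rule: less_induct)
  case less
  from e less.prems(1) show ?case
  proof (cases rule: binary_tree_family_cases)
    case (leaf k)
    then show ?thesis using less.prems e by (auto simp: binary_tree_family_def)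
  next
    case (node k l)
    have lt: "card (S - {k}) < card S" "card (S - {l}) < card S"
      using card_Diff1_less[OF finite node(3)] card_Diff1_less[OF finite node(4)] by blast+
    \<comment> \<open>\<open>k < l\<close> and \<open>i \<le> j\<close> exclude the crossed match
      \<open>i = l\<close>, \<open>j = k\<close>.\<close>
    consider "k \<notin> {i, j}" | "l \<notin> {i, j}" | "i = k" "j = l"
      using \<open>k < l\<close> \<open>i \<le> j\<close> by force
    then show ?thesis
    proof cases
      case 1
      then show ?thesis using less.hyps[OF lt(1) node(5)] less.prems by auto
    next
      case 2
      then show ?thesis using less.hyps[OF lt(2) node(6)] less.prems by auto
    qed (use node in auto)
  qed
qed

text \<open>Let \<open>S = e (k, l)\<close>. If the child \<open>S - {k}\<close> is a node, its own
  children arise by deleting an element of its index pair \<open>{p, q}\<close>. If \<open>l\<close>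
  were not in that pair, the least-member property would put \<open>S - {k}\<close> inside
  \<open>S - {l}\<close>, although it contains \<open>l\<close>.\<close>

lemma binary_tree_family_grandchild:
  fixes e :: "'n::{finite, linorder} \<times> 'n \<Rightarrow> 'n set"
  assumes e: "binary_tree_family e" and "k < l"
  shows "e (k, l) - {k, l} \<in> insert {} (e ` index_pairs)"
proof -
  define S where "S = e (k, l)"
  have S: "k \<in> S" "l \<in> S" "S - {k} \<in> e ` index_pairs" "S - {l} \<in> e ` index_pairs"
    using assms unfolding binary_tree_family_def S_def by metis+
  have eq: "S - {k, l} = S - {k} - {l}" by auto
  from e S(3) have "S - {k} - {l} \<in> insert {} (e ` index_pairs)"
  proof (cases rule: binary_tree_family_cases)
    case (leaf m)
    then show ?thesis using S assms by auto
  next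
    case (node p q)
    have "l \<in> {p, q}"
    proof (rule ccontr)
      assume "l \<notin> {p, q}"
      then have "p \<in> S - {l}" "q \<in> S - {l}" using node by auto
      then have "S - {k} \<subseteq> S - {l}"
        using binary_tree_family_subset[OF e S(4), of p q] node by auto
      then show False using S \<open>k < l\<close> by auto
    qed
    then show ?thesis using node by auto
  qed
  then show ?thesis using eq S_def by simp
qed

text \<open>Off the diagonal this is the mixed difference at \<open>e (k, l)\<close> in directions
  \<open>k\<close> and \<open>l\<close>; on the diagonal it is the first difference
  \<open>\<phi> {k} - \<phi> {}\<close>, as it is applied to \<open>\<phi>\<close> with
  \<open>\<phi> {} = 0\<close>.\<close>

definition second_difference ::
    "('n::linorder \<times> 'n \<Rightarrow> 'n set) \<Rightarrow> ('n set \<Rightarrow> real) \<Rightarrow> 'n \<times> 'n \<Rightarrow> real" where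
  "second_difference e \<phi> = (\<lambda>(k, l). if k = l then \<phi> {k}
     else \<phi> (e (k, l)) - \<phi> (e (k, l) - {k}) - \<phi> (e (k, l) - {l}) + \<phi> (e (k, l) - {k, l}))"

text \<open>Inclusion-exclusion: a pair in \<open>S = e (k, l)\<close> other than
  \<open>(k, l)\<close> avoids \<open>k\<close> or \<open>l\<close>, hence lies in a child, and
  pairs in both children lie in the grandchild. The grandchild can be empty, so the induction
  includes \<open>{}\<close>.\<close>

lemma sum_second_difference:
  fixes e :: "'n::{finite, linorder} \<times> 'n \<Rightarrow> 'n set"
  assumes e: "binary_tree_family e" and "\<phi> {} = 0"
    and "S \<in> insert {} (e ` index_pairs)"
  shows "\<phi> S = (\<Sum>q\<in>pairs_in S. second_difference e \<phi> q)"
  using assms(3)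
proof (induction "card S" arbitrary: S rule: less_induct)
  case less
  show ?case
  proof (cases "S = {}")
    case True
    then show ?thesis using \<open>\<phi> {} = 0\<close> by simp
  next
    case False
    with less.prems have "S \<in> e ` index_pairs" by simp
    with e show ?thesis
    proof (cases rule: binary_tree_family_cases)
      case (leaf k)
      then have "pairs_in S = {(k, k)}" by (auto simp: index_pairs_def)
      then show ?thesis using leaf by (simp add: second_difference_def)
    next
      case (node k l)
      have gc: "S - {k, l} \<in> insert {} (e ` index_pairs)"
        using binary_tree_family_grandchild[OF e node(1)] node by simp
      have lt: "card (S - {k}) < card S" "card (S - {l}) < card S" "card (S - {k, l}) < card S"
        by ((rule psubset_card_mono, simp), use node(3,4) in blast)+
      let ?\<psi> = "second_difference e \<phi>"
      have ih: "\<phi> (S - {k}) = sum ?\<psi> (pairs_in (S - {k}))"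
        "\<phi> (S - {l}) = sum ?\<psi> (pairs_in (S - {l}))"
        "\<phi> (S - {k, l}) = sum ?\<psi> (pairs_in (S - {k, l}))"
        using less.hyps[OF lt(1)] less.hyps[OF lt(2)] less.hyps[OF lt(3) gc] node by auto
      have un: "pairs_in S = insert (k, l) (pairs_in (S - {k}) \<union> pairs_in (S - {l}))"
      proof (intro equalityI subsetI)
        fix q
        assume q: "q \<in> pairs_in S"
        show "q \<in> insert (k, l) (pairs_in (S - {k}) \<union> pairs_in (S - {l}))"
        proof (cases "k \<in> {fst q, snd q} \<and> l \<in> {fst q, snd q}")
          case True
          then have "fst q = k \<and> snd q = l"
            using q \<open>k < l\<close> by (force simp: index_pairs_def)
          then have "q = (k, l)" by (simp add: prod_eq_iff)
          then show ?thesis by simp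
        qed (use q in blast)
      next
        have "(k, l) \<in> pairs_in S" using node(1,3,4) by (simp add: index_pairs_def)
        then show "q \<in> pairs_in S"
          if "q \<in> insert (k, l) (pairs_in (S - {k}) \<union> pairs_in (S - {l}))" for q
          using that by blast
      qed
      have int: "pairs_in (S - {k, l}) = pairs_in (S - {k}) \<inter> pairs_in (S - {l})"
        by blast
      have "sum ?\<psi> (pairs_in S) =
          ?\<psi> (k, l) + sum ?\<psi> (pairs_in (S - {k}) \<union> pairs_in (S - {l}))"
        unfolding un by (rule sum.insert) auto
      also have "\<dots> = ?\<psi> (k, l) + sum ?\<psi> (pairs_in (S - {k})) + sum ?\<psi> (pairs_in (S - {l}))
          - sum ?\<psi> (pairs_in (S - {k, l}))"
        unfolding int by (subst sum_Un) auto
      also have "\<dots> = \<phi> S"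
        using node unfolding ih[symmetric] by (simp add: second_difference_def)
      finally show ?thesis ..
    qed
  qed
qed

text \<open>Exchanging the sums gives each second difference one coefficient. Off the diagonal,
  supermodularity at the two children of \<open>e (k, l)\<close> gives its sign; on the diagonal
  \<open>\<phi> {k}\<close> has no known sign, hence the equality in \<open>diag\<close>.\<close>

lemma tree_sum_nonneg:
  fixes e :: "'n::{finite, linorder} \<times> 'n \<Rightarrow> 'n set" and c :: "'n \<times> 'n \<Rightarrow> real"
  assumes e: "binary_tree_family e" and \<phi>0: "\<phi> {} = 0"
    and \<phi>: "\<And>A B. \<phi> A + \<phi> B \<le> \<phi> (A \<inter> B) + \<phi> (A \<union> B)"
    and diag: "\<And>i. (\<Sum>p\<in>index_pairs. if i \<in> e p then c p else 0) = 0"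
    and off: "\<And>i j. i < j \<Longrightarrow> 0 \<le> (\<Sum>p\<in>index_pairs. if i \<in> e p \<and> j \<in> e p then c p else 0)"
  shows "0 \<le> (\<Sum>p\<in>index_pairs. c p * \<phi> (e p))"
proof -
  let ?\<psi> = "second_difference e \<phi>"
  have "(\<Sum>p\<in>index_pairs. c p * \<phi> (e p)) =
      (\<Sum>p\<in>index_pairs. \<Sum>q\<in>index_pairs. if fst q \<in> e p \<and> snd q \<in> e p then c p * ?\<psi> q else 0)"
  proof (rule sum.cong[OF refl])
    fix p :: "'n \<times> 'n"
    assume "p \<in> index_pairs"
    then have "\<phi> (e p) = (\<Sum>q\<in>pairs_in (e p). ?\<psi> q)"
      by (intro sum_second_difference[where \<phi> = \<phi>, OF e \<phi>0]) simp
    also have "\<dots> = (\<Sum>q\<in>index_pairs. if fst q \<in> e p \<and> snd q \<in> e p then ?\<psi> q else 0)"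
      by (rule sum.inter_filter) simp
    finally show "c p * \<phi> (e p) =
        (\<Sum>q\<in>index_pairs. if fst q \<in> e p \<and> snd q \<in> e p then c p * ?\<psi> q else 0)"
      unfolding sum_distrib_left by (simp only: sum_distrib_left if_distrib mult_zero_right)
  qed
  also have "\<dots> = (\<Sum>q\<in>index_pairs.
      ?\<psi> q * (\<Sum>p\<in>index_pairs. if fst q \<in> e p \<and> snd q \<in> e p then c p else 0))"
    by (subst sum.swap) (auto simp: sum_distrib_left intro!: sum.cong)
  also have "\<dots> \<ge> 0"
  proof (rule sum_nonneg)
    fix q :: "'n \<times> 'n"
    assume "q \<in> index_pairs"
    then obtain k l where q: "q = (k, l)" "k \<le> l" by (auto simp: index_pairs_def)
    show "0 \<le> ?\<psi> q * (\<Sum>p\<in>index_pairs. if fst q \<in> e p \<and> snd q \<in> e p then c p else 0)"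
    proof (cases "k = l")
      case True
      then show ?thesis using q diag[of k] by simp
    next
      case False
      then have "k < l" using q by simp
      have un: "(e (k, l) - {k}) \<union> (e (k, l) - {l}) = e (k, l)"
        and int: "(e (k, l) - {k}) \<inter> (e (k, l) - {l}) = e (k, l) - {k, l}"
        using False by auto
      have "0 \<le> ?\<psi> q"
        using \<phi>[of "e (k, l) - {k}" "e (k, l) - {l}"] False q unfolding un int
        by (simp add: second_difference_def)
      then show ?thesis using off[OF \<open>k < l\<close>] q by simp
    qed
  qed
  finally show ?thesis .
qed

section \<open>Jump operators\<close>

lemma inf_vec_nth: "inf x y $ i = inf (x $ i) (y $ i)"
  for x y :: "real ^ 'n::finite"
  by (simp add: inf_vec_def)

lemma sup_vec_nth: "sup x y $ i = sup (x $ i) (y $ i)"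
  for x y :: "real ^ 'n::finite"
  by (simp add: sup_vec_def)

text \<open>The summand \<open>c * f x\<close> stands for jumps of size 0 at rate \<open>c\<close>.\<close>

definition jump_op ::
    "real \<Rightarrow> 'i set \<Rightarrow> ('i \<Rightarrow> real) \<Rightarrow> ('i \<Rightarrow> 'v) \<Rightarrow> ('v \<Rightarrow> real) \<Rightarrow> 'v::real_vector \<Rightarrow> real" where
  "jump_op c J a v f x = c * f x + (\<Sum>p\<in>J. a p * f (x + v p))"

lemma funpow_jump_op_Suc:
  "(jump_op c J a v ^^ Suc s) f x =
    c * (jump_op c J a v ^^ s) f x + (\<Sum>p\<in>J. a p * (jump_op c J a v ^^ s) f (x + v p))"
  by (simp add: jump_op_def)

lemma jump_op_mono:
  assumes "0 \<le> c" "\<And>p. p \<in> J \<Longrightarrow> 0 \<le> a p" "\<And>x. f x \<le> g x"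
  shows "jump_op c J a v f x \<le> jump_op c J a v g x"
  unfolding jump_op_def using assms by (intro add_mono sum_mono mult_left_mono) auto

lemma funpow_jump_op_nonneg:
  assumes "0 \<le> c" "\<And>p. p \<in> J \<Longrightarrow> 0 \<le> a p" "\<And>x. 0 \<le> f x"
  shows "0 \<le> (jump_op c J a v ^^ s) f x"
proof (induction s arbitrary: x)
  case (Suc s)
  show ?case
    unfolding funpow_jump_op_Suc using assms Suc by (intro add_nonneg_nonneg sum_nonneg mult_nonneg_nonneg)
qed (use assms in simp)

text \<open>Used to recombine the positive and negative parts of an integrable function.\<close>

lemma funpow_jump_op_diff:
  "(jump_op c J a v ^^ s) (\<lambda>x. f x - g x) = (\<lambda>x. (jump_op c J a v ^^ s) f x - (jump_op c J a v ^^ s) g x)"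
proof (induction s)
  case (Suc s)
  show ?case
    unfolding fun_eq_iff funpow_jump_op_Suc Suc by (simp add: algebra_simps sum_subtractf)
qed simp

text \<open>Translations commute with \<open>inf\<close> and \<open>sup\<close>, and supermodularity
  survives nonnegative combinations.\<close>

lemma supermodular_jump_op:
  fixes v :: "'i \<Rightarrow> real ^ 'n::finite"
  assumes "supermodular f" "0 \<le> c" "\<And>p. p \<in> J \<Longrightarrow> 0 \<le> a p"
  shows "supermodular (jump_op c J a v f)"
  unfolding supermodular_def
proof (intro allI)
  fix x y :: "real ^ 'n"
  have *: "f (x + u) + f (y + u) \<le> f (inf x y + u) + f (sup x y + u)" for u
  proof -
    have "inf (x + u) (y + u) = inf x y + u" "sup (x + u) (y + u) = sup x y + u"
      by (simp_all add: vec_eq_iff inf_vec_nth sup_vec_nth inf_min sup_max min_add_distrib_left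
          max_add_distrib_left)
    then show ?thesis using assms(1) unfolding supermodular_def by metis
  qed
  have "jump_op c J a v f x + jump_op c J a v f y =
      c * (f x + f y) + (\<Sum>p\<in>J. a p * (f (x + v p) + f (y + v p)))"
    by (simp add: jump_op_def algebra_simps sum.distrib)
  also have "\<dots> \<le> c * (f (inf x y) + f (sup x y))
      + (\<Sum>p\<in>J. a p * (f (inf x y + v p) + f (sup x y + v p)))"
    by (rule add_mono[OF mult_left_mono sum_mono[OF mult_left_mono]])
      (use assms *[of 0] * in simp_all)
  also have "\<dots> = jump_op c J a v f (inf x y) + jump_op c J a v f (sup x y)"
    by (simp add: jump_op_def algebra_simps sum.distrib)
  finally show "jump_op c J a v f x + jump_op c J a v f y
      \<le> jump_op c J a v f (inf x y) + jump_op c J a v f (sup x y)" .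
qed

text \<open>One operator is exchanged at a time: monotonicity of the first carries the induction
  hypothesis, then \<open>le\<close> replaces the outermost operator, applied to an iterate of the
  second, which is still supermodular.\<close>

lemma funpow_jump_op_le:
  fixes v :: "'i \<Rightarrow> real ^ 'n::finite"
  assumes "supermodular f" "0 \<le> c" "\<And>p. p \<in> J \<Longrightarrow> 0 \<le> a p"
    and "0 \<le> c'" "\<And>p. p \<in> J \<Longrightarrow> 0 \<le> b p"
    and le: "\<And>f x. supermodular f \<Longrightarrow> jump_op c J a v f x \<le> jump_op c' J b v f x"
  shows "(jump_op c J a v ^^ s) f x \<le> (jump_op c' J b v ^^ s) f x"
proof -
  have sm: "supermodular ((jump_op c' J b v ^^ s) f)" for s
    by (induction s) (use assms in \<open>auto intro: supermodular_jump_op\<close>)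
  show ?thesis
  proof (induction s arbitrary: x)
    case (Suc s)
    have "jump_op c J a v ((jump_op c J a v ^^ s) f) x \<le> jump_op c J a v ((jump_op c' J b v ^^ s) f) x"
      by (rule jump_op_mono[OF assms(2,3) Suc])
    also have "\<dots> \<le> jump_op c' J b v ((jump_op c' J b v ^^ s) f) x"
      by (rule le[OF sm])
    finally show ?case by simp
  qed simp
qed

text \<open>
  The binomial theorem for the commuting operators \<open>jump_op c J a v\<close> and \<open>f \<mapsto> a q * f (\<cdot> + v q)\<close>;
  the induction on \<open>s\<close> writes \<open>s + 1 = (s + 1 - k) + k\<close> in each term of the convolution.
\<close>

lemma funpow_jump_op_insert:
  assumes "finite J" "q \<notin> J"
  shows "(jump_op c (insert q J) a v ^^ s) f x / fact s =
    (\<Sum>k\<le>s. a q ^ k / fact k * ((jump_op c J a v ^^ (s - k)) f (x + real k *\<^sub>R v q) / fact (s - k)))"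
proof (induction s arbitrary: x)
  case (Suc s)
  let ?L = "jump_op c J a v" and ?L' = "jump_op c (insert q J) a v"
  \<comment> \<open>Divided powers: raising the index of \<open>r\<close> or \<open>l\<close> by one
    operator step yields a factor equal to the new index. \<open>F\<close> is their convolution, the
    claimed value at \<open>s\<close>.\<close>
  define r where "r k = a q ^ k / fact k" for k
  define l where "l m x = (?L ^^ m) f x / fact m" for m x
  define F where "F s x = (\<Sum>k\<le>s. r k * l (s - k) (x + real k *\<^sub>R v q))" for s x
  have l_Suc: "?L (l m) x = real (Suc m) * l (Suc m) x" for m x
  proof -
    have "?L (l m) x = ?L ((?L ^^ m) f) x / fact m"
      by (simp add: jump_op_def l_def sum_divide_distrib add_divide_distrib)
    then show ?thesis by (simp add: l_def)
  qed
  have r_Suc: "a q * r k = real (Suc k) * r (Suc k)" for k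
    by (simp add: r_def)
  have "?L (F s) x = (\<Sum>k\<le>s. r k * ?L (l (s - k)) (x + real k *\<^sub>R v q))"
    unfolding jump_op_def F_def
    by (simp add: sum_distrib_left sum.distrib algebra_simps) (subst sum.swap, simp)
  also have "\<dots> = (\<Sum>k\<le>s. real (Suc s - k) * (r k * l (Suc s - k) (x + real k *\<^sub>R v q)))"
    by (intro sum.cong refl) (simp add: l_Suc Suc_diff_le)
  \<comment> \<open>The added term \<open>k = Suc s\<close> has factor 0, as has the term
    \<open>k = 0\<close> added in the next computation. Both sums now have the same range, and their
    factors \<open>Suc s - k\<close> and \<open>k\<close> add up to \<open>Suc s\<close>.\<close>
  also have "\<dots> = (\<Sum>k\<le>Suc s. real (Suc s - k) * (r k * l (Suc s - k) (x + real k *\<^sub>R v q)))"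
    by simp
  finally have 1: "?L (F s) x = \<dots>" .
  have "a q * F s (x + v q) =
      (\<Sum>k\<le>s. real (Suc k) * (r (Suc k) * l (Suc s - Suc k) (x + real (Suc k) *\<^sub>R v q)))"
    unfolding F_def sum_distrib_left
  proof (rule sum.cong[OF refl])
    fix k
    have "a q * (r k * l (s - k) (x + v q + real k *\<^sub>R v q)) =
        (a q * r k) * l (s - k) (x + v q + real k *\<^sub>R v q)"
      by (simp only: mult.assoc)
    then show "a q * (r k * l (s - k) (x + v q + real k *\<^sub>R v q)) =
        real (Suc k) * (r (Suc k) * l (Suc s - Suc k) (x + real (Suc k) *\<^sub>R v q))"
      unfolding r_Suc by (simp add: algebra_simps)
  qed
  also have "\<dots> = (\<Sum>k\<le>Suc s. real k * (r k * l (Suc s - k) (x + real k *\<^sub>R v q)))"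
    by (subst sum.atMost_Suc_shift) simp
  finally have 2: "a q * F s (x + v q) = \<dots>" .
  have "?L' (F s) x = ?L (F s) x + a q * F s (x + v q)"
    using assms by (simp add: jump_op_def)
  also have "\<dots> = real (Suc s) * F (Suc s) x"
    unfolding 1 2 unfolding F_def sum_distrib_left sum.distrib[symmetric]
    by (intro sum.cong refl) (auto simp: of_nat_diff algebra_simps)
  finally have 3: "?L' (F s) x = real (Suc s) * F (Suc s) x" .
  have "(?L' ^^ s) f = (\<lambda>x. fact s * F s x)"
    using Suc by (simp add: F_def r_def l_def fun_eq_iff field_simps)
  then have "(?L' ^^ Suc s) f x = ?L' (\<lambda>x. fact s * F s x) x" by simp
  also have "\<dots> = fact s * ?L' (F s) x"
    by (simp add: jump_op_def sum_distrib_left algebra_simps)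
  also have "\<dots> = fact (Suc s) * F (Suc s) x" by (simp add: 3)
  finally show ?case by (simp add: F_def r_def l_def del: funpow.simps)
qed simp

section \<open>Integrals against Poisson laws as series in the jump operators\<close>

lemma suminf_ennreal_Cauchy:
  fixes g :: "nat \<Rightarrow> nat \<Rightarrow> ennreal"
  shows "(\<Sum>s. \<Sum>k\<le>s. g k (s - k)) = (\<Sum>k. \<Sum>m. g k m)"
proof -
  have "(\<Sum>k. if k \<le> s then g k (s - k) else 0) = (\<Sum>k\<le>s. g k (s - k))" for s
    by (subst suminf_finite[of "{..s}"]) auto
  then have "(\<Sum>s. \<Sum>k\<le>s. g k (s - k)) = (\<Sum>s. \<Sum>k. if k \<le> s then g k (s - k) else 0)"
    by simp
  \<comment> \<open>Tonelli: the outer series is read as an integral over the counting measure, to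
    interchange it with the inner one.\<close>
  also have "\<dots> = (\<integral>\<^sup>+s. (\<Sum>k. if k \<le> s then g k (s - k) else 0) \<partial>count_space UNIV)"
    by (simp add: nn_integral_count_space_nat)
  also have "\<dots> = (\<Sum>k. \<Sum>s. if k \<le> s then g k (s - k) else 0)"
    by (subst nn_integral_suminf) (auto simp: nn_integral_count_space_nat)
  also have "\<dots> = (\<Sum>k. \<Sum>m. g k m)"
  proof (rule suminf_cong)
    fix k
    have "(\<Sum>s. if k \<le> s then g k (s - k) else 0)
        = (\<Sum>s. if k \<le> s + k then g k (s + k - k) else 0) + (\<Sum>s<k. if k \<le> s then g k (s - k) else 0)"
      by (rule suminf_offset) auto
    then show "(\<Sum>s. if k \<le> s then g k (s - k) else 0) = (\<Sum>m. g k m)"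
      by simp
  qed
  finally show ?thesis .
qed

lemma nn_integral_poisson_law:
  assumes "0 \<le> a"
  shows "(\<integral>\<^sup>+n. h n \<partial>measure_pmf (poisson_law a)) =
    ennreal (exp (- a)) * (\<Sum>n. ennreal (a ^ n / fact n) * h n)"
proof -
  \<comment> \<open>At rate 0 the convention \<open>0 ^ 0 = 1\<close> makes the formula give the
    point mass at 0.\<close>
  have "ennreal (pmf (poisson_law a) n) = ennreal (exp (- a)) * ennreal (a ^ n / fact n)" for n
    using assms by (cases n) (auto simp: poisson_law_def mult.commute simp flip: ennreal_mult')
  then show ?thesis
    by (simp add: nn_integral_measure_pmf nn_integral_count_space_nat mult.assoc)
qed

text \<open>Informally the right side is \<open>exp (L - \<Lambda>) f z\<close> for the jump
  operator \<open>L\<close> with total rate \<open>\<Lambda>\<close>. Integrating out one coordinate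
  shifts the start \<open>z\<close> and convolves its Poisson weights with the series for the rest.
  The left side does not depend on \<open>c\<close>, so \<open>c\<close> can be chosen to equalize
  two total rates.\<close>

lemma nn_integral_poisson_sum:
  fixes v :: "'i \<Rightarrow> 'v::real_vector" and f :: "'v \<Rightarrow> real"
  assumes "finite J" "\<And>p. p \<in> J \<Longrightarrow> 0 \<le> a p" "0 \<le> c" and f: "\<And>x. 0 \<le> f x"
  shows "(\<integral>\<^sup>+n. ennreal (f (z + (\<Sum>p\<in>J. real (n p) *\<^sub>R v p)))
      \<partial>PiM J (\<lambda>p. measure_pmf (poisson_law (a p)))) =
    ennreal (exp (- (c + (\<Sum>p\<in>J. a p)))) * (\<Sum>s. ennreal ((jump_op c J a v ^^ s) f z / fact s))"
  using assms(1,2)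
proof (induction J arbitrary: z rule: finite_induct)
  case empty
  have "(jump_op c {} a v ^^ s) f z = c ^ s * f z" for s
    by (induction s arbitrary: z) (simp_all add: jump_op_def mult_ac)
  then have "(\<Sum>s. ennreal ((jump_op c {} a v ^^ s) f z / fact s)) =
      (\<Sum>s. ennreal (c ^ s / fact s)) * ennreal (f z)"
    unfolding ennreal_suminf_multc[symmetric] using \<open>0 \<le> c\<close> f by (simp flip: ennreal_mult)
  also have "\<dots> = ennreal (exp c) * ennreal (f z)"
  proof -
    have "(\<lambda>s. c ^ s / fact s) sums exp c"
      using exp_converges[of c] by (simp add: divide_inverse mult.commute)
    then show ?thesis using \<open>0 \<le> c\<close> by (subst suminf_ennreal_eq[where x = "exp c"]) (auto simp: mult.commute)
  qed
  finally have "ennreal (exp (- c)) * (\<Sum>s. ennreal ((jump_op c {} a v ^^ s) f z / fact s)) =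
      ennreal (exp (- c) * (exp c * f z))"
    using f by (simp add: ennreal_mult)
  also have "\<dots> = ennreal (f z)"
    by (simp flip: mult.assoc exp_add)
  finally show ?case
    by (simp add: PiM_empty nn_integral_count_space_finite)
next
  case (insert q J)
  let ?M = "\<lambda>p. measure_pmf (poisson_law (a p))"
  let ?l = "\<lambda>m z. ennreal ((jump_op c J a v ^^ m) f z / fact m)"
  interpret product_sigma_finite ?M
    by (simp add: product_sigma_finite_def prob_space_imp_sigma_finite measure_pmf.prob_space_axioms)
  \<comment> \<open>A finite product of countable discrete spaces is discrete, so every integrand is
    measurable, whatever \<open>f\<close> is.\<close>
  have sets: "sets (PiM (insert q J) ?M) = sets (count_space (PiE (insert q J) (\<lambda>_. UNIV)))"
    using insert(1) by (subst count_space_PiM_finite[symmetric]) (auto intro!: sets_PiM_cong)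
  have "(\<integral>\<^sup>+n. ennreal (f (z + (\<Sum>p\<in>insert q J. real (n p) *\<^sub>R v p))) \<partial>PiM (insert q J) ?M)
      = (\<integral>\<^sup>+k. (\<integral>\<^sup>+n. ennreal (f (z + (\<Sum>p\<in>insert q J. real ((n(q := k)) p) *\<^sub>R v p)))
          \<partial>PiM J ?M) \<partial>?M q)"
    using insert(1,2) by (intro product_nn_integral_insert_rev) (auto simp: measurable_cong_sets[OF sets])
  also have "\<dots> = (\<integral>\<^sup>+k. (\<integral>\<^sup>+n. ennreal (f ((z + real k *\<^sub>R v q) + (\<Sum>p\<in>J. real (n p) *\<^sub>R v p)))
          \<partial>PiM J ?M) \<partial>?M q)"
  proof -
    have "(\<Sum>p\<in>insert q J. real ((n(q := k)) p) *\<^sub>R v p) = real k *\<^sub>R v q + (\<Sum>p\<in>J. real (n p) *\<^sub>R v p)"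
      for n k
    proof -
      have "(\<Sum>p\<in>J. real ((n(q := k)) p) *\<^sub>R v p) = (\<Sum>p\<in>J. real (n p) *\<^sub>R v p)"
        using insert(2) by (intro sum.cong) auto
      then show ?thesis using insert(1,2) by simp
    qed
    then show ?thesis by (simp only: add.assoc)
  qed
  also have "\<dots> = (\<integral>\<^sup>+k. ennreal (exp (- (c + sum a J))) * (\<Sum>m. ?l m (z + real k *\<^sub>R v q)) \<partial>?M q)"
    using insert by (intro nn_integral_cong) auto
  also have "\<dots> = ennreal (exp (- (c + sum a J))) * (ennreal (exp (- a q)) *
      (\<Sum>k. ennreal (a q ^ k / fact k) * (\<Sum>m. ?l m (z + real k *\<^sub>R v q))))"
    using insert(4) by (simp add: nn_integral_cmult nn_integral_poisson_law)
  \<comment> \<open>Regrouping by the total number \<open>s = k + m\<close> of jumps makes the inner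
    sum the binomial expansion of \<open>funpow_jump_op_insert\<close>.\<close>
  also have "(\<Sum>k. ennreal (a q ^ k / fact k) * (\<Sum>m. ?l m (z + real k *\<^sub>R v q))) =
      (\<Sum>s. \<Sum>k\<le>s. ennreal (a q ^ k / fact k) * ?l (s - k) (z + real k *\<^sub>R v q))"
    unfolding ennreal_suminf_cmult[symmetric]
    by (rule suminf_ennreal_Cauchy[symmetric,
          where g = "\<lambda>k m. ennreal (a q ^ k / fact k) * ?l m (z + real k *\<^sub>R v q)"])
  also have "\<dots> = (\<Sum>s. ennreal ((jump_op c (insert q J) a v ^^ s) f z / fact s))"
  proof (rule suminf_cong)
    fix s
    have nn: "0 \<le> (jump_op c J a v ^^ m) f y" for m y
      using insert(4) \<open>0 \<le> c\<close> f by (intro funpow_jump_op_nonneg) auto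
    show "(\<Sum>k\<le>s. ennreal (a q ^ k / fact k) * ?l (s - k) (z + real k *\<^sub>R v q)) =
        ennreal ((jump_op c (insert q J) a v ^^ s) f z / fact s)"
      unfolding funpow_jump_op_insert[OF insert(1,2)]
      using insert(4) nn
      by (subst sum_ennreal[symmetric]) (auto simp del: times_divide_eq_left times_divide_eq_right
          simp: ennreal_mult intro!: sum.cong)
  qed
  also have "ennreal (exp (- (c + sum a J))) * (ennreal (exp (- a q)) *
      (\<Sum>s. ennreal ((jump_op c (insert q J) a v ^^ s) f z / fact s))) =
      ennreal (exp (- (c + sum a (insert q J)))) *
      (\<Sum>s. ennreal ((jump_op c (insert q J) a v ^^ s) f z / fact s))"
  proof -
    have "- (c + sum a (insert q J)) = - (c + sum a J) + - a q"
      using insert(1,2) by simp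
    then show ?thesis by (simp only: exp_add ennreal_mult' exp_ge_zero mult.assoc)
  qed
  finally show ?case .
qed

section \<open>Poisson vectors carried by a tree\<close>

text \<open>Each operator receives the other's total rate as its rate of zero jumps. The difference
  at \<open>x\<close> is then the sum of \<open>b p - a p\<close> times the increment
  \<open>\<phi> (e p)\<close>, and \<open>\<phi>\<close> inherits supermodularity because
  \<open>S \<mapsto> x + cube_vec S\<close> respects meets and joins.\<close>

lemma jump_op_cube_le:
  fixes e :: "'n::{finite, linorder} \<times> 'n \<Rightarrow> 'n set" and a b :: "'n \<times> 'n \<Rightarrow> real"
  assumes e: "binary_tree_family e" and f: "supermodular f"
    and diag: "\<And>i. (\<Sum>p\<in>index_pairs. if i \<in> e p then b p - a p else 0) = 0"
    and off: "\<And>i j. i < j \<Longrightarrow> 0 \<le> (\<Sum>p\<in>index_pairs. if i \<in> e p \<and> j \<in> e p then b p - a p else 0)"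
  shows "jump_op (sum b index_pairs) index_pairs a (\<lambda>p. cube_vec (e p)) f x
    \<le> jump_op (sum a index_pairs) index_pairs b (\<lambda>p. cube_vec (e p)) f x"
proof -
  define \<phi> where "\<phi> S = f (x + cube_vec S) - f x" for S
  have 0: "\<phi> {} = 0"
  proof -
    have "cube_vec {} = (0 :: real ^ ('n::{finite, linorder}))" by (simp add: cube_vec_def vec_eq_iff)
    then show ?thesis by (simp add: \<phi>_def)
  qed
  have sm: "\<phi> A + \<phi> B \<le> \<phi> (A \<inter> B) + \<phi> (A \<union> B)" for A B
  proof -
    have "inf (x + cube_vec A) (x + cube_vec B) = x + cube_vec (A \<inter> B)"
      "sup (x + cube_vec A) (x + cube_vec B) = x + cube_vec (A \<union> B)"
      by (auto simp: vec_eq_iff inf_vec_nth sup_vec_nth cube_vec_def inf_min sup_max indicator_def)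
    then have "f (x + cube_vec A) + f (x + cube_vec B)
        \<le> f (x + cube_vec (A \<inter> B)) + f (x + cube_vec (A \<union> B))"
      using f unfolding supermodular_def by metis
    then show ?thesis by (simp add: \<phi>_def)
  qed
  have "0 \<le> (\<Sum>p\<in>index_pairs. (b p - a p) * \<phi> (e p))"
    by (rule tree_sum_nonneg[OF e 0 sm diag off])
  then show ?thesis
    by (simp add: \<phi>_def jump_op_def algebra_simps sum.distrib sum_subtractf sum_distrib_left)
qed

section \<open>Moments and expectations of Poisson tree vectors\<close>

lemma poisson_moments:
  assumes "0 \<le> a"
  shows has_bochner_integral_poisson_law: "has_bochner_integral (measure_pmf (poisson_law a)) real a"
    and has_bochner_integral_poisson_law_square:
      "has_bochner_integral (measure_pmf (poisson_law a)) (\<lambda>n. real n * real n) (a * a + a)"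
proof -
  have 0: "(\<lambda>n. a ^ n / fact n) sums exp a"
    using exp_converges[of a] by (simp add: divide_inverse mult.commute)
  \<comment> \<open>One factor \<open>Suc n\<close> cancels against the factorial, so each moment
    series is a shift of series already summed; its term at 0 vanishes.\<close>
  have eq: "a ^ Suc n / fact (Suc n) * real (Suc n) = a * (a ^ n / fact n)" for n
    by (simp del: of_nat_Suc)
  have eq': "a ^ Suc n / fact (Suc n) * (real (Suc n) * real (Suc n)) =
      a * (a ^ n / fact n * real n + a ^ n / fact n)" for n
    unfolding mult.assoc[symmetric] eq by (simp add: algebra_simps add_divide_distrib)
  have 1: "(\<lambda>n. a ^ n / fact n * real n) sums (a * exp a)"
    using sums_Suc[where f = "\<lambda>n. a ^ n / fact n * real n", unfolded eq, OF sums_mult[OF 0]]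
    by simp
  have 2: "(\<lambda>n. a ^ n / fact n * (real n * real n)) sums (a * (a * exp a + exp a))"
    using sums_Suc[where f = "\<lambda>n. a ^ n / fact n * (real n * real n)", unfolded eq',
        OF sums_mult[OF sums_add[OF 1 0]]]
    by simp
  have *: "has_bochner_integral (measure_pmf (poisson_law a)) h (exp (- a) * l)"
    if "(\<lambda>n. a ^ n / fact n * h n) sums l" "\<And>n. 0 \<le> h n" for h l
  proof (rule has_bochner_integral_nn_integral)
    have l: "0 \<le> l"
      using that \<open>0 \<le> a\<close> by (intro sums_le[OF _ sums_zero that(1)]) simp
    then show "0 \<le> exp (- a) * l" by simp
    have "(\<Sum>n. ennreal (a ^ n / fact n) * ennreal (h n)) = (\<Sum>n. ennreal (a ^ n / fact n * h n))"
      using that(2) \<open>0 \<le> a\<close> by (simp add: ennreal_mult del: times_divide_eq_left)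
    also have "\<dots> = ennreal l"
      using that \<open>0 \<le> a\<close> by (intro suminf_ennreal_eq) auto
    finally show "(\<integral>\<^sup>+n. ennreal (h n) \<partial>measure_pmf (poisson_law a)) = ennreal (exp (- a) * l)"
      using l by (simp add: nn_integral_poisson_law[OF \<open>0 \<le> a\<close>] ennreal_mult)
  qed (use that in auto)
  have exp: "exp (- a) * (a * exp a) = a" "exp (- a) * (a * (a * exp a + exp a)) = a * a + a"
    by (simp_all add: exp_minus field_simps)
  then show "has_bochner_integral (measure_pmf (poisson_law a)) real a"
    "has_bochner_integral (measure_pmf (poisson_law a)) (\<lambda>n. real n * real n) (a * a + a)"
    using *[OF 1, unfolded exp(1)] *[OF 2, unfolded exp(2)] by simp_all
qed

text \<open>Treats a single vector, to be instantiated once for \<open>X\<close> and once for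
  \<open>Y\<close>.\<close>

locale poisson_tree = prob_space M
  for M :: "'a measure" and e :: "'n::{finite, linorder} \<times> 'n \<Rightarrow> 'n set"
    and a :: "'n \<times> 'n \<Rightarrow> real" and X :: "'n \<times> 'n \<Rightarrow> 'a \<Rightarrow> nat" +
  assumes rate_nonneg: "p \<in> index_pairs \<Longrightarrow> 0 \<le> a p"
    and family: "independent_poisson_family M a index_pairs X"
begin

lemma indep: "indep_vars (\<lambda>_. count_space UNIV) X index_pairs"
  and law: "p \<in> index_pairs \<Longrightarrow> distr M (count_space UNIV) (X p) = measure_pmf (poisson_law (a p))"
  using family by (auto simp: independent_poisson_family_def)

lemma measurable_X: "p \<in> index_pairs \<Longrightarrow> X p \<in> measurable M (count_space UNIV)"
  using indep by (auto simp: indep_vars_def)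

text \<open>Independence makes the joint law of the jump counts the product of their Poisson laws,
  so \<open>nn_integral_poisson_sum\<close> applies with start \<open>z = 0\<close>.\<close>

lemma nn_integral_tree_vector:
  assumes "0 \<le> c" and f: "\<And>x. 0 \<le> f x"
  shows "(\<integral>\<^sup>+\<omega>. ennreal (f (tree_vector e X \<omega>)) \<partial>M) =
    ennreal (exp (- (c + sum a index_pairs))) *
    (\<Sum>s. ennreal ((jump_op c index_pairs a (\<lambda>p. cube_vec (e p)) ^^ s) f 0 / fact s))"
proof -
  let ?I = "index_pairs :: ('n \<times> 'n) set"
  let ?C = "PiM ?I (\<lambda>_. count_space (UNIV :: nat set))"
  let ?g = "\<lambda>n. ennreal (f (0 + (\<Sum>p\<in>?I. real (n p) *\<^sub>R cube_vec (e p))))"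
  have ne: "?I \<noteq> {}" by (auto simp: index_pairs_def)
  have C: "?C = count_space (PiE ?I (\<lambda>_. UNIV))"
    by (rule count_space_PiM_finite) auto
  have "distr M ?C (\<lambda>\<omega>. \<lambda>p\<in>?I. X p \<omega>) = PiM ?I (\<lambda>p. distr M (count_space UNIV) (X p))"
    using indep_vars_iff_distr_eq_PiM'[where X = X, OF ne measurable_X] indep by blast
  also have "\<dots> = PiM ?I (\<lambda>p. measure_pmf (poisson_law (a p)))"
    by (intro PiM_cong) (simp_all add: law)
  finally have distr: "distr M ?C (\<lambda>\<omega>. \<lambda>p\<in>?I. X p \<omega>) = \<dots>" .
  have "(\<integral>\<^sup>+\<omega>. ennreal (f (tree_vector e X \<omega>)) \<partial>M) = (\<integral>\<^sup>+\<omega>. ?g (\<lambda>p\<in>?I. X p \<omega>) \<partial>M)"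
    by (simp add: tree_vector_def)
  also have "\<dots> = (\<integral>\<^sup>+n. ?g n \<partial>distr M ?C (\<lambda>\<omega>. \<lambda>p\<in>?I. X p \<omega>))"
  proof (rule nn_integral_distr[symmetric])
    show "(\<lambda>\<omega>. \<lambda>p\<in>?I. X p \<omega>) \<in> measurable M ?C"
      by (intro measurable_restrict measurable_X)
    have "?g \<in> borel_measurable ?C"
      unfolding C by simp
    then show "?g \<in> borel_measurable (distr M ?C (\<lambda>\<omega>. \<lambda>p\<in>?I. X p \<omega>))"
      by simp
  qed
  also have "\<dots> = ennreal (exp (- (c + sum a index_pairs))) *
      (\<Sum>s. ennreal ((jump_op c ?I a (\<lambda>p. cube_vec (e p)) ^^ s) f 0 / fact s))"
    unfolding distr using assms rate_nonneg by (intro nn_integral_poisson_sum) auto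
  finally show ?thesis .
qed

text \<open>For nonnegative functions a finite integral forces convergence of the series. A general
  integrable \<open>f\<close> is split into positive and negative parts, and linearity of the
  iterates subtracts the two series termwise.\<close>

lemma expectation_tree_vector_sums:
  assumes c: "0 \<le> c" and int: "integrable M (\<lambda>\<omega>. f (tree_vector e X \<omega>))"
  shows "(\<lambda>s. exp (- (c + sum a index_pairs)) *
      ((jump_op c index_pairs a (\<lambda>p. cube_vec (e p)) ^^ s) f 0 / fact s))
    sums expectation (\<lambda>\<omega>. f (tree_vector e X \<omega>))"
proof -
  let ?E = "exp (- (c + sum a index_pairs))"
  let ?L = "jump_op c index_pairs a (\<lambda>p. cube_vec (e p))"
  have nonneg: "(\<lambda>s. ?E * ((?L ^^ s) g 0 / fact s)) sums expectation (\<lambda>\<omega>. g (tree_vector e X \<omega>))"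
    if g: "\<And>x. 0 \<le> g x" and int: "integrable M (\<lambda>\<omega>. g (tree_vector e X \<omega>))" for g
  proof -
    have nn: "0 \<le> ?E * ((?L ^^ s) g 0 / fact s)" for s
      using funpow_jump_op_nonneg[where f = g and x = 0 and a = a and J = index_pairs, OF c rate_nonneg g] by simp
    have "(\<Sum>s. ennreal (?E * ((?L ^^ s) g 0 / fact s))) =
        ennreal ?E * (\<Sum>s. ennreal ((?L ^^ s) g 0 / fact s))"
      unfolding ennreal_suminf_cmult[symmetric] by (simp only: ennreal_mult' exp_ge_zero)
    also have "\<dots> = ennreal (expectation (\<lambda>\<omega>. g (tree_vector e X \<omega>)))"
      using nn_integral_eq_integral[OF int] g nn_integral_tree_vector[OF c, of g] by simp
    finally have eq: "(\<Sum>s. ennreal (?E * ((?L ^^ s) g 0 / fact s))) = \<dots>" .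
    have "(\<lambda>s. ennreal (?E * ((?L ^^ s) g 0 / fact s))) sums
        ennreal (expectation (\<lambda>\<omega>. g (tree_vector e X \<omega>)))"
      unfolding eq[symmetric] by (rule summable_sums[OF summableI])
    then show ?thesis
      using nn g by (subst (asm) sums_ennreal) auto
  qed
  let ?p = "\<lambda>x. max 0 (f x)" and ?n = "\<lambda>x. max 0 (- f x)"
  have f: "f = (\<lambda>x. ?p x - ?n x)" by (auto simp: fun_eq_iff)
  have ip: "integrable M (\<lambda>\<omega>. ?p (tree_vector e X \<omega>))"
    and i_n: "integrable M (\<lambda>\<omega>. ?n (tree_vector e X \<omega>))"
    using int by auto
  have "expectation (\<lambda>\<omega>. ?p (tree_vector e X \<omega>)) - expectation (\<lambda>\<omega>. ?n (tree_vector e X \<omega>)) =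
      expectation (\<lambda>\<omega>. f (tree_vector e X \<omega>))"
    by (subst Bochner_Integration.integral_diff[OF ip i_n, symmetric]) (auto intro!: Bochner_Integration.integral_cong)
  moreover have "?E * ((?L ^^ s) ?p 0 / fact s) - ?E * ((?L ^^ s) ?n 0 / fact s) =
      ?E * ((?L ^^ s) f 0 / fact s)" for s
    using funpow_jump_op_diff[of s c index_pairs a "\<lambda>p. cube_vec (e p)" ?p ?n] unfolding f[symmetric]
    by (simp add: algebra_simps diff_divide_distrib)
  ultimately show ?thesis
    using sums_diff[OF nonneg[OF _ ip] nonneg[OF _ i_n]] by simp
qed

lemma has_bochner_integral_X:
  assumes "p \<in> index_pairs"
  shows "has_bochner_integral M (\<lambda>\<omega>. real (X p \<omega>)) (a p)"
    and "has_bochner_integral M (\<lambda>\<omega>. real (X p \<omega>) * real (X p \<omega>)) (a p * a p + a p)"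
proof -
  have "has_bochner_integral M (\<lambda>\<omega>. h (X p \<omega>)) l"
    if "has_bochner_integral (measure_pmf (poisson_law (a p))) h l" for h :: "nat \<Rightarrow> real" and l
    using that measurable_X[OF assms]
    by (simp add: has_bochner_integral_iff law[OF assms, symmetric] integrable_distr_eq integral_distr)
  from this[OF has_bochner_integral_poisson_law] this[OF has_bochner_integral_poisson_law_square]
  show "has_bochner_integral M (\<lambda>\<omega>. real (X p \<omega>)) (a p)"
    and "has_bochner_integral M (\<lambda>\<omega>. real (X p \<omega>) * real (X p \<omega>)) (a p * a p + a p)"
    using rate_nonneg[OF assms] by auto
qed

lemma has_bochner_integral_X_mult:
  assumes p: "p \<in> index_pairs" and q: "q \<in> index_pairs"
  shows "has_bochner_integral M (\<lambda>\<omega>. real (X p \<omega>) * real (X q \<omega>))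
    (a p * a q + (if p = q then a p else 0))"
proof (cases "p = q")
  case True
  then show ?thesis using has_bochner_integral_X(2)[OF p] by simp
next
  case False
  have "indep_vars (\<lambda>_. count_space UNIV) X {p, q}"
    using indep_vars_subset[OF indep] p q by auto
  then have iv: "indep_vars (\<lambda>_. borel) (\<lambda>p \<omega>. real (X p \<omega>)) {p, q}"
    by (rule indep_vars_compose2) auto
  have X: "integrable M (\<lambda>\<omega>. real (X r \<omega>))" "expectation (\<lambda>\<omega>. real (X r \<omega>)) = a r" if "r \<in> {p, q}" for r
  proof -
    have "r \<in> index_pairs" using that p q by auto
    then show "integrable M (\<lambda>\<omega>. real (X r \<omega>))" "expectation (\<lambda>\<omega>. real (X r \<omega>)) = a r"
      using has_bochner_integral_X(1) unfolding has_bochner_integral_iff by blast+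
  qed
  show ?thesis
    using indep_vars_lebesgue_integral[OF _ iv X(1)] indep_vars_integrable[OF _ iv X(1)] X(2) False
    by (simp add: has_bochner_integral_iff)
qed

lemma tree_vector_nth: "tree_vector e X \<omega> $ i = (\<Sum>p\<in>index_pairs. if i \<in> e p then real (X p \<omega>) else 0)"
  unfolding tree_vector_def cube_vec_def sum_component by (intro sum.cong) (auto simp: indicator_def)

definition "rate_through i = (\<Sum>p\<in>index_pairs. if i \<in> e p then a p else 0)"

definition "joint_rate_through i j = (\<Sum>p\<in>index_pairs. if i \<in> e p \<and> j \<in> e p then a p else 0)"

lemma has_bochner_integral_nth:
  "has_bochner_integral M (\<lambda>\<omega>. tree_vector e X \<omega> $ i) (rate_through i)"
  unfolding tree_vector_nth rate_through_def
  using has_bochner_integral_X(1) by (intro has_bochner_integral_sum) auto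

text \<open>Distinct counts are uncorrelated, so beyond the product of the means only the terms
  \<open>p = q\<close> contribute, each with the Poisson variance \<open>a p\<close>.\<close>

lemma has_bochner_integral_nth_mult:
  "has_bochner_integral M (\<lambda>\<omega>. tree_vector e X \<omega> $ i * tree_vector e X \<omega> $ j)
    (rate_through i * rate_through j + joint_rate_through i j)"
proof -
  have "has_bochner_integral M
      (\<lambda>\<omega>. \<Sum>p\<in>index_pairs. \<Sum>q\<in>index_pairs. if i \<in> e p \<and> j \<in> e q then real (X p \<omega>) * real (X q \<omega>) else 0)
      (\<Sum>p\<in>index_pairs. \<Sum>q\<in>index_pairs.
        if i \<in> e p \<and> j \<in> e q then a p * a q + (if p = q then a p else 0) else 0)"
    using has_bochner_integral_X_mult by (intro has_bochner_integral_sum) auto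
  also have "(\<lambda>\<omega>. \<Sum>p\<in>index_pairs. \<Sum>q\<in>index_pairs.
      if i \<in> e p \<and> j \<in> e q then real (X p \<omega>) * real (X q \<omega>) else 0) =
      (\<lambda>\<omega>. tree_vector e X \<omega> $ i * tree_vector e X \<omega> $ j)"
    unfolding tree_vector_nth sum_product by (intro ext sum.cong) auto
  also have "(\<Sum>p\<in>index_pairs. \<Sum>q\<in>index_pairs.
        if i \<in> e p \<and> j \<in> e q then a p * a q + (if p = q then a p else 0) else 0) =
      (\<Sum>p\<in>index_pairs. \<Sum>q\<in>index_pairs.
        (if i \<in> e p then a p else 0) * (if j \<in> e q then a q else 0) +
        (if p = q then if i \<in> e p \<and> j \<in> e p then a p else 0 else 0))"
    by (intro sum.cong) auto
  also have "\<dots> = rate_through i * rate_through j + joint_rate_through i j"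
    unfolding rate_through_def joint_rate_through_def sum_product sum.distrib by simp
  finally show ?thesis .
qed

lemma covariance_nth:
  "covariance M (\<lambda>\<omega>. tree_vector e X \<omega> $ i) (\<lambda>\<omega>. tree_vector e X \<omega> $ j) = joint_rate_through i j"
proof -
  let ?X = "\<lambda>i \<omega>. tree_vector e X \<omega> $ i"
  have E: "expectation (?X k) = rate_through k" for k
    using has_bochner_integral_nth by (rule has_bochner_integral_integral_eq)
  have "has_bochner_integral M (\<lambda>\<omega>. ?X i \<omega> * ?X j \<omega> - rate_through j * ?X i \<omega> - rate_through i * ?X j \<omega>
        + rate_through i * rate_through j)
      (rate_through i * rate_through j + joint_rate_through i j - rate_through j * rate_through i
        - rate_through i * rate_through j + rate_through i * rate_through j)"
    by (intro has_bochner_integral_add has_bochner_integral_diff has_bochner_integral_mult_right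
        has_bochner_integral_nth has_bochner_integral_nth_mult) (auto simp: has_bochner_integral_iff prob_space)
  then show ?thesis
    unfolding covariance_def E
    by (intro has_bochner_integral_integral_eq) (simp add: algebra_simps)
qed

end

section \<open>Test functions and the equivalence\<close>

lemma supermodular_nth: "supermodular (\<lambda>x. x $ i)" "supermodular (\<lambda>x. - (x $ i))"
  by (auto simp: supermodular_def inf_vec_nth sup_vec_nth inf_min sup_max)

text \<open>If \<open>x\<close> and \<open>y\<close> are ordered alike in both coordinates, equality
  holds; if oppositely, the gain is a product of two nonnegative differences.\<close>

lemma supermodular_nth_mult: "supermodular (\<lambda>x. x $ i * x $ j)"
  unfolding supermodular_def
proof (intro allI)
  fix x y :: "real ^ 'a"
  have *: "p * q + r * s \<le> r * q + p * s" if "r \<le> p" "q \<le> s" for p q r s :: real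
    using mult_nonneg_nonneg[of "p - r" "s - q"] that by (simp add: algebra_simps)
  show "x $ i * x $ j + y $ i * y $ j \<le> inf x y $ i * inf x y $ j + sup x y $ i * sup x y $ j"
    using *[of "y $ i" "x $ i" "x $ j" "y $ j"] *[of "x $ i" "y $ i" "y $ j" "x $ j"]
    by (auto simp: inf_vec_nth sup_vec_nth inf_min sup_max min_def max_def)
qed

theorem theorem4p2:
  fixes e :: "'n::{finite, linorder} \<times> 'n \<Rightarrow> 'n set"
    and M :: "'a measure" and N :: "'b measure"
    and a b :: "'n \<times> 'n \<Rightarrow> real"
    and XX :: "'n \<times> 'n \<Rightarrow> 'a \<Rightarrow> nat" and YY :: "'n \<times> 'n \<Rightarrow> 'b \<Rightarrow> nat"
    and X :: "'a \<Rightarrow> real ^ ('n::{finite, linorder})" and Y :: "'b \<Rightarrow> real ^ ('n::{finite, linorder})"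
  assumes "binary_tree_family e"
    and "prob_space M" and "prob_space N"
    and "\<And>k l. k \<le> l \<Longrightarrow> 0 \<le> a (k, l)"
    and "\<And>k l. k \<le> l \<Longrightarrow> 0 \<le> b (k, l)"
    and "independent_poisson_family M a index_pairs XX"
    and "independent_poisson_family N b index_pairs YY"
    and "X = tree_vector e XX" and "Y = tree_vector e YY"
  shows "((\<forall>i. prob_space.expectation M (\<lambda>\<omega>. X \<omega> $ i) = prob_space.expectation N (\<lambda>\<omega>. Y \<omega> $ i)) \<and>
          (\<forall>i j. i < j \<longrightarrow>
             covariance M (\<lambda>\<omega>. X \<omega> $ i) (\<lambda>\<omega>. X \<omega> $ j)
               \<le> covariance N (\<lambda>\<omega>. Y \<omega> $ i) (\<lambda>\<omega>. Y \<omega> $ j)))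
         \<longleftrightarrow> supermodular_le M X N Y"
proof -
  let ?I = "index_pairs :: ('n \<times> 'n) set"
  interpret X: poisson_tree M e a XX
    using assms by (auto simp: poisson_tree_def poisson_tree_axioms_def index_pairs_def)
  interpret Y: poisson_tree N e b YY
    using assms by (auto simp: poisson_tree_def poisson_tree_axioms_def index_pairs_def)
  note X = X.has_bochner_integral_nth[folded assms(8)] X.has_bochner_integral_nth_mult[folded assms(8)]
    X.covariance_nth[folded assms(8)]
  note Y = Y.has_bochner_integral_nth[folded assms(9)] Y.has_bochner_integral_nth_mult[folded assms(9)]
    Y.covariance_nth[folded assms(9)]
  have EX: "X.expectation (\<lambda>\<omega>. X \<omega> $ i) = X.rate_through i"
    and EY: "Y.expectation (\<lambda>\<omega>. Y \<omega> $ i) = Y.rate_through i" for i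
    using X(1) Y(1) by (auto simp: has_bochner_integral_iff)
  have "((\<forall>i. X.rate_through i = Y.rate_through i) \<and>
      (\<forall>i j. i < j \<longrightarrow> X.joint_rate_through i j \<le> Y.joint_rate_through i j))
    \<longleftrightarrow> supermodular_le M X N Y"
  proof
    assume moments: "(\<forall>i. X.rate_through i = Y.rate_through i) \<and>
      (\<forall>i j. i < j \<longrightarrow> X.joint_rate_through i j \<le> Y.joint_rate_through i j)"
    have diag: "(\<Sum>p\<in>?I. if i \<in> e p then b p - a p else 0) = 0" for i
    proof -
      have "(\<Sum>p\<in>?I. if i \<in> e p then b p - a p else 0) = Y.rate_through i - X.rate_through i"
        unfolding X.rate_through_def Y.rate_through_def sum_subtractf[symmetric]
        by (intro sum.cong) auto
      then show ?thesis using moments by simp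
    qed
    have off: "0 \<le> (\<Sum>p\<in>?I. if i \<in> e p \<and> j \<in> e p then b p - a p else 0)" if "i < j" for i j
    proof -
      have "(\<Sum>p\<in>?I. if i \<in> e p \<and> j \<in> e p then b p - a p else 0) =
          Y.joint_rate_through i j - X.joint_rate_through i j"
        unfolding X.joint_rate_through_def Y.joint_rate_through_def sum_subtractf[symmetric]
        by (intro sum.cong) auto
      then show ?thesis using moments that by simp
    qed
    let ?v = "\<lambda>p. cube_vec (e p)"
    \<comment> \<open>The crossed totals give both vectors the rate
      \<open>sum a ?I + sum b ?I\<close>; the exponential factors agree and the series compare term
      by term.\<close>
    let ?LX = "jump_op (sum b ?I) ?I a ?v" and ?LY = "jump_op (sum a ?I) ?I b ?v"
    have nn: "0 \<le> sum a ?I" "0 \<le> sum b ?I"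
      using X.rate_nonneg Y.rate_nonneg by (auto intro: sum_nonneg)
    show "supermodular_le M X N Y"
      unfolding supermodular_le_def
    proof (intro allI impI)
      fix \<Phi> :: "real ^ ('n::{finite, linorder}) \<Rightarrow> real"
      assume \<Phi>: "supermodular \<Phi>"
        and int: "integrable M (\<lambda>\<omega>. \<Phi> (X \<omega>))" "integrable N (\<lambda>\<omega>. \<Phi> (Y \<omega>))"
      have "(?LX ^^ s) \<Phi> 0 \<le> (?LY ^^ s) \<Phi> 0" for s
        using \<Phi> nn X.rate_nonneg Y.rate_nonneg jump_op_cube_le[OF assms(1) _ diag off]
        by (intro funpow_jump_op_le) auto
      then have "exp (- (sum b ?I + sum a ?I)) * ((?LX ^^ s) \<Phi> 0 / fact s)
          \<le> exp (- (sum a ?I + sum b ?I)) * ((?LY ^^ s) \<Phi> 0 / fact s)" for s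
        by (simp add: add.commute divide_right_mono)
      moreover have "(\<lambda>s. exp (- (sum b ?I + sum a ?I)) * ((?LX ^^ s) \<Phi> 0 / fact s))
          sums X.expectation (\<lambda>\<omega>. \<Phi> (X \<omega>))"
        using X.expectation_tree_vector_sums[OF nn(2)] int(1) unfolding assms(8) .
      moreover have "(\<lambda>s. exp (- (sum a ?I + sum b ?I)) * ((?LY ^^ s) \<Phi> 0 / fact s))
          sums Y.expectation (\<lambda>\<omega>. \<Phi> (Y \<omega>))"
        using Y.expectation_tree_vector_sums[OF nn(1)] int(2) unfolding assms(9) .
      ultimately show "X.expectation (\<lambda>\<omega>. \<Phi> (X \<omega>)) \<le> Y.expectation (\<lambda>\<omega>. \<Phi> (Y \<omega>))"
        by (rule sums_le)
    qed
  next
    assume le: "supermodular_le M X N Y"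
    have mono: "x \<le> y" if "supermodular \<Phi>" "has_bochner_integral M (\<lambda>\<omega>. \<Phi> (X \<omega>)) x"
      "has_bochner_integral N (\<lambda>\<omega>. \<Phi> (Y \<omega>)) y" for \<Phi> x y
      using le that unfolding supermodular_le_def has_bochner_integral_iff by blast
    have "X.rate_through i \<le> Y.rate_through i" for i
      by (rule mono[OF supermodular_nth(1) X(1) Y(1)])
    \<comment> \<open>A coordinate and its negative are both supermodular, which turns the
      inequality of means into an equality.\<close>
    moreover have "- X.rate_through i \<le> - Y.rate_through i" for i
      using X(1) Y(1) by (intro mono[OF supermodular_nth(2)[of i]] has_bochner_integral_minus)
    ultimately have means: "X.rate_through i = Y.rate_through i" for i
      by (simp add: order_antisym)
    \<comment> \<open>With equal means, the products of means cancel from the mixed moments and the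
      covariances remain.\<close>
    moreover have "X.joint_rate_through i j \<le> Y.joint_rate_through i j" for i j
      using mono[OF supermodular_nth_mult X(2) Y(2), of i j] by (simp add: means)
    ultimately show "(\<forall>i. X.rate_through i = Y.rate_through i) \<and>
      (\<forall>i j. i < j \<longrightarrow> X.joint_rate_through i j \<le> Y.joint_rate_through i j)" by blast
  qed
  then show ?thesis by (simp only: EX EY X(3) Y(3))
qed

end
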